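(* Let $\mathcal{H}$ be a separable complex Hilbert space, $(X,\mu)$ a measure space with $\sigma$-finite positive measure, and let $F:X\to\mathcal{H}$ be a continuous frame for $\mathcal{H}$ with respect to $(X,\mu)$, with frame operator $S_F$. The dual frames of $F$ are precisely the functions $$G(x)=S_F^{-1}F(x)+\Theta(x)-\int_X\langle S_F^{-1}F(x),F(y)\rangle\,\Theta(y)\,d\mu(y),\qquad x\in X,$$ where $\Theta:X\to\mathcal{H}$ is a Bessel mapping.
   Context: A weakly measurable mapping $F:X\to\mathcal{H}$ (i.e. $x\mapsto\langle f,F(x)\rangle$ is measurable for every $f\in\mathcal{H}$) is a continuous frame for $\mathcal{H}$ with respect to $(X,\mu)$ if there are $A>0$, $B<\infty$ with $A\|f\|^2\le\int_X|\langle f,F(x)\rangle|^2d\mu(x)\le B\|f\|^2$ for all $f\in\mathcal{H}$; it is a Bessel mapping if only the upper inequality is required. For a Bessel mapping, the synthesis operator $T_F:L^2(X,\mu)\to\mathcal{H}$, $T_F\varphi=\int_X\varphi(x)F(x)d\mu(x)$, is bounded with adjoint $(T_F^*f)(x)=\langle f,F(x)\rangle$; the frame operator is $S_F=T_FT_F^*$, which is boundedly invertible if $F$ is a continuous frame. All vector-valued integrals are understood in the weak sense. A continuous frame $G$ is a dual frame of $F$ if $\langle f,g\rangle=\int_X\langle f,F(x)\rangle\langle G(x),g\rangle\,d\mu(x)$ for all $f,g\in\mathcal{H}$. *)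

theory Defs
  imports "HOL-Analysis.Analysis"
begin

section \<open>Complex Hilbert spaces\<close>

text \<open>The inner product is linear in its \<^emph>\<open>first\<close> argument, so that the analysis map
  \<open>f \<mapsto> (\<lambda>x. \<langle>f, F x\<rangle>)\<close> of a mapping \<open>F\<close> is linear.\<close>

class scaleC =
  fixes scaleC :: "complex \<Rightarrow> 'a \<Rightarrow> 'a"  (infixr "*\<^sub>C" 75)

class complex_inner = real_normed_vector + scaleC +
  fixes cinner :: "'a \<Rightarrow> 'a \<Rightarrow> complex"
  assumes scaleR_eq_scaleC: "r *\<^sub>R x = complex_of_real r *\<^sub>C x"
    and scaleC_add_right: "a *\<^sub>C (x + y) = a *\<^sub>C x + a *\<^sub>C y"
    and scaleC_add_left: "(a + b) *\<^sub>C x = a *\<^sub>C x + b *\<^sub>C x"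
    and scaleC_scaleC: "a *\<^sub>C (b *\<^sub>C x) = (a * b) *\<^sub>C x"
    and scaleC_one: "1 *\<^sub>C x = x"
    and cinner_commute: "cinner x y = cnj (cinner y x)"
    and cinner_add_left: "cinner (x + y) z = cinner x z + cinner y z"
    and cinner_scaleC_left: "cinner (a *\<^sub>C x) y = a * cinner x y"
    and cinner_nonneg: "0 \<le> Re (cinner x x)"
    and cinner_eq_zero_iff: "cinner x x = 0 \<longleftrightarrow> x = 0"
    and norm_eq_sqrt_cinner: "norm x = sqrt (Re (cinner x x))"

class complex_hilbert = complex_inner + complete_space

instantiation complex :: complex_hilbert
begin

definition scaleC_complex :: "complex \<Rightarrow> complex \<Rightarrow> complex" where
  "scaleC_complex a x = a * x"

definition cinner_complex :: "complex \<Rightarrow> complex \<Rightarrow> complex" where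
  "cinner_complex x y = x * cnj y"

instance
  by standard
    (auto simp: scaleC_complex_def cinner_complex_def scaleR_conv_of_real cmod_def
      algebra_simps power2_eq_square)

end

section \<open>Weak integrals\<close>

definition has_weak_integral :: "'x measure \<Rightarrow> ('x \<Rightarrow> 'h::complex_hilbert) \<Rightarrow> 'h \<Rightarrow> bool" where
  "has_weak_integral M u v \<longleftrightarrow>
     (\<forall>g. integrable M (\<lambda>x. cinner (u x) g) \<and> (\<integral>x. cinner (u x) g \<partial>M) = cinner v g)"

definition weak_integral :: "'x measure \<Rightarrow> ('x \<Rightarrow> 'h::complex_hilbert) \<Rightarrow> 'h" where
  "weak_integral M u = (THE v. has_weak_integral M u v)"

lemma has_weak_integral_unique:
  assumes "has_weak_integral M u v" "has_weak_integral M u w"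
  shows "v = w"
proof -
  have eq: "cinner v g = cinner w g" for g
    using assms unfolding has_weak_integral_def by metis
  have "cinner v g = cinner (v - w) g + cinner w g" for g
    using cinner_add_left[of "v - w" w g] by simp
  hence "cinner (v - w) g = 0" for g
    using eq by (metis add_cancel_left_left)
  hence "v - w = 0"
    using cinner_eq_zero_iff by blast
  thus ?thesis by simp
qed

lemma weak_integral_eq: "has_weak_integral M u v \<Longrightarrow> weak_integral M u = v"
  unfolding weak_integral_def by (blast intro: has_weak_integral_unique)

section \<open>Continuous frames\<close>

definition weakly_measurable :: "'x measure \<Rightarrow> ('x \<Rightarrow> 'h::complex_hilbert) \<Rightarrow> bool" where
  "weakly_measurable M F \<longleftrightarrow> (\<forall>f. (\<lambda>x. cinner f (F x)) \<in> borel_measurable M)"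

definition bessel_mapping :: "'x measure \<Rightarrow> ('x \<Rightarrow> 'h::complex_hilbert) \<Rightarrow> bool" where
  "bessel_mapping M F \<longleftrightarrow> weakly_measurable M F \<and>
     (\<exists>B::real. 0 \<le> B \<and>
       (\<forall>f. (\<integral>\<^sup>+ x. ennreal ((cmod (cinner f (F x)))\<^sup>2) \<partial>M) \<le> ennreal (B * (norm f)\<^sup>2)))"

definition continuous_frame :: "'x measure \<Rightarrow> ('x \<Rightarrow> 'h::complex_hilbert) \<Rightarrow> bool" where
  "continuous_frame M F \<longleftrightarrow> weakly_measurable M F \<and>
     (\<exists>A B::real. 0 < A \<and> 0 \<le> B \<and>
       (\<forall>f. ennreal (A * (norm f)\<^sup>2) \<le> (\<integral>\<^sup>+ x. ennreal ((cmod (cinner f (F x)))\<^sup>2) \<partial>M) \<and>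
            (\<integral>\<^sup>+ x. ennreal ((cmod (cinner f (F x)))\<^sup>2) \<partial>M) \<le> ennreal (B * (norm f)\<^sup>2)))"

text \<open>Elements of $L^2(X,\mu)$ are represented by square-integrable functions; the value of
  \<open>synthesis M F \<phi>\<close> depends only on the class of \<open>\<phi>\<close> modulo null sets. The map
  \<open>analysis F\<close> is the adjoint of the synthesis operator of a Bessel mapping \<open>F\<close>.\<close>

definition synthesis :: "'x measure \<Rightarrow> ('x \<Rightarrow> 'h::complex_hilbert) \<Rightarrow> ('x \<Rightarrow> complex) \<Rightarrow> 'h" where
  "synthesis M F \<phi> = weak_integral M (\<lambda>x. \<phi> x *\<^sub>C F x)"

definition analysis :: "('x \<Rightarrow> 'h::complex_hilbert) \<Rightarrow> 'h \<Rightarrow> ('x \<Rightarrow> complex)" where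
  "analysis F f = (\<lambda>x. cinner f (F x))"

definition frame_operator :: "'x measure \<Rightarrow> ('x \<Rightarrow> 'h::complex_hilbert) \<Rightarrow> 'h \<Rightarrow> 'h" where
  "frame_operator M F = synthesis M F \<circ> analysis F"

definition dual_frame ::
    "'x measure \<Rightarrow> ('x \<Rightarrow> 'h::complex_hilbert) \<Rightarrow> ('x \<Rightarrow> 'h) \<Rightarrow> bool" where
  "dual_frame M F G \<longleftrightarrow> continuous_frame M G \<and>
     (\<forall>f g. cinner f g = (\<integral>x. cinner f (F x) * cinner (G x) g \<partial>M))"

end

theory Submission
  imports Defs
begin

text \<open>For Bessel mappings \<open>\<Phi>\<close> and \<open>\<Psi>\<close> let \<open>T\<^sub>\<Phi>\<^sub>\<Psi> f = \<integral> \<langle>f, \<Phi> x\<rangle> \<Psi> x\<close>; this is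
  \<open>mixed_operator M \<Phi> \<Psi>\<close> below. Everything reduces to the calculus of these operators. They exist by
  the Riesz representation theorem (\<open>has_weak_integral_synthesis\<close>), they are bounded by the
  Cauchy--Schwarz inequality in \<open>L\<^sup>2\<close>, the adjoint of \<open>T\<^sub>\<Phi>\<^sub>\<Psi>\<close> is \<open>T\<^sub>\<Psi>\<^sub>\<Phi>\<close>, and
  replacing \<open>\<Psi>\<close> by \<open>L \<circ> \<Psi>\<close> with \<open>L\<close> bounded gives \<open>L T\<^sub>\<Phi>\<^sub>\<Psi>\<close>. The frame operator of \<open>F\<close> is \<open>S = T\<^sub>F\<^sub>F\<close>, and a Bessel
  mapping \<open>G\<close> is a dual frame of \<open>F\<close> exactly when \<open>T\<^sub>F\<^sub>G\<close> is the identity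
  (\<open>dual_frame_iff\<close>); the lower frame bound of \<open>G\<close> then comes for free from the Cauchy--Schwarz
  inequality.

  With \<open>T = T\<^sub>F\<^sub>\<Theta>\<close> the formula reads \<open>G x = \<Theta> x - U (F x)\<close>, where \<open>U = T S\<^sup>-\<^sup>1 - S\<^sup>-\<^sup>1\<close>.
  The operator \<open>U\<close> is bounded with bounded adjoint, so \<open>G\<close> is Bessel, and
  \<open>T\<^sub>F\<^sub>G = T - U S = T - (T - id) = id\<close>. Conversely, if \<open>G\<close> is a dual frame, the choice
  \<open>\<Theta> = G\<close> works: then \<open>T = id\<close>, and \<open>S\<^sup>-\<^sup>1 F x\<close> cancels against the integral.

  The Riesz theorem and the surjectivity of \<open>S\<close> are two instances of one fact about coercive
  symmetric forms on complete spaces, \<open>coercive_symmetric_form_represents\<close>: for the inner product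
  itself, and for the form \<open>\<langle>S f, g\<rangle>\<close>, whose coercivity is the lower frame bound.\<close>

section \<open>Complex inner products\<close>

lemma cinner_add_right: "cinner x (y + z) = cinner x y + cinner x (z::'a::complex_inner)"
  by (metis cinner_add_left cinner_commute complex_cnj_add)

lemma cinner_scaleC_right: "cinner x (a *\<^sub>C y) = cnj a * cinner x (y::'a::complex_inner)"
  by (metis cinner_commute cinner_scaleC_left complex_cnj_mult)

lemma cinner_scaleR_left: "cinner (r *\<^sub>R x) y = of_real r * cinner x (y::'a::complex_inner)"
  by (simp add: scaleR_eq_scaleC cinner_scaleC_left)

lemma cinner_scaleR_right: "cinner x (r *\<^sub>R y) = of_real r * cinner x (y::'a::complex_inner)"
  by (simp add: scaleR_eq_scaleC cinner_scaleC_right)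

lemma cinner_diff_left: "cinner (x - y) z = cinner x z - cinner y (z::'a::complex_inner)"
  using cinner_add_left[of "x - y" y z] by simp

lemma cinner_diff_right: "cinner x (y - z) = cinner x y - cinner x (z::'a::complex_inner)"
  using cinner_add_right[of x "y - z" z] by simp

lemma cinner_self: "cinner x x = of_real ((norm (x::'a::complex_inner))\<^sup>2)"
proof -
  have "Im (cinner x x) = 0"
    using cinner_commute[of x x] by (simp add: complex_eq_iff)
  then show ?thesis
    using cinner_nonneg[of x] by (simp add: complex_eq_iff norm_eq_sqrt_cinner)
qed

lemma cinner_eqI:
  fixes u v :: "'a::complex_inner"
  assumes "\<And>g. cinner u g = cinner v g"
  shows "u = v"
  using assms[of "u - v"] cinner_diff_left[of u v "u - v"] cinner_eq_zero_iff[of "u - v"] by simp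

lemma norm_add_squared:
  "(norm (x + y))\<^sup>2 = (norm x)\<^sup>2 + 2 * Re (cinner x y) + (norm (y::'a::complex_inner))\<^sup>2"
proof -
  have "Re (cinner (x + y) (x + y)) = Re (cinner x x) + 2 * Re (cinner x y) + Re (cinner y y)"
    using cinner_commute[of y x] by (simp add: cinner_add_left cinner_add_right)
  then show ?thesis by (simp add: cinner_self)
qed

text \<open>The norm is already known to satisfy the triangle inequality, which bounds the real part of
  the inner product; multiplying \<open>x\<close> by a phase turns the modulus into a real part.\<close>

lemma cmod_cinner_le: "cmod (cinner x y) \<le> norm x * norm (y::'a::complex_inner)"
proof -
  have Re_le: "Re (cinner u v) \<le> norm u * norm v" for u v :: 'a
  proof -
    have "(norm (u + v))\<^sup>2 \<le> (norm u + norm v)\<^sup>2"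
      by (simp add: norm_triangle_ineq power_mono)
    then show ?thesis
      unfolding norm_add_squared by (simp add: power2_eq_square algebra_simps)
  qed
  show ?thesis
  proof (cases "cinner x y = 0")
    case False
    define a where "a = cnj (sgn (cinner x y))"
    have a: "a * cnj a = 1"
      unfolding a_def using False
      by (metis complex_cnj_cnj complex_norm_square mult.commute norm_sgn of_real_1 one_power2)
    have "(norm (a *\<^sub>C x))\<^sup>2 = (norm x)\<^sup>2"
    proof -
      have "cinner (a *\<^sub>C x) (a *\<^sub>C x) = (a * cnj a) * cinner x x"
        by (simp add: cinner_scaleC_left cinner_scaleC_right)
      then show ?thesis unfolding a by (simp add: cinner_self flip: of_real_power)
    qed
    then have n: "norm (a *\<^sub>C x) = norm x" by simp
    have "a * cinner x y = of_real (cmod (cinner x y))"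
      unfolding a_def sgn_eq complex_cnj_divide using False complex_norm_square[of "cinner x y"]
      by (simp add: field_simps power2_eq_square)
    then have "Re (cinner (a *\<^sub>C x) y) = cmod (cinner x y)"
      by (simp add: cinner_scaleC_left)
    then show ?thesis using Re_le[of "a *\<^sub>C x" y] n by simp
  qed simp
qed

lemma norm_le_of_cinner_bound:
  fixes v :: "'a::complex_inner"
  assumes "0 \<le> C" "\<And>g. cmod (cinner v g) \<le> C * norm g"
  shows "norm v \<le> C"
proof (cases "v = 0")
  case True
  then show ?thesis using assms(1) by simp
next
  case False
  have "norm v * norm v \<le> C * norm v"
    using assms(2)[of v] by (simp add: cinner_self power2_eq_square norm_mult)
  then show ?thesis using False by simp
qed

section \<open>Coercive quadratic forms\<close>

text \<open>The symmetric case of the Lax--Milgram theorem. The solution is the minimiser of the energy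
  \<open>b f f - 2 * \<phi> f\<close>: coercivity makes the energy bounded below and every minimising sequence
  Cauchy, and the vanishing of the first variation at the minimiser is the claim.\<close>

lemma coercive_symmetric_form_represents:
  fixes b :: "'a::{real_normed_vector,complete_space} \<Rightarrow> 'a \<Rightarrow> real"
  assumes b: "bounded_bilinear b" and sym: "\<And>f g. b f g = b g f"
    and A: "0 < A" "\<And>f. A * (norm f)\<^sup>2 \<le> b f f"
    and \<phi>: "bounded_linear \<phi>"
  shows "\<exists>u. \<forall>g. b u g = \<phi> g"
proof -
  interpret b: bounded_bilinear b by fact
  interpret \<phi>: bounded_linear \<phi> by fact
  define J where "J f = b f f - 2 * \<phi> f" for f
  obtain K where K: "\<And>f. \<bar>\<phi> f\<bar> \<le> norm f * K" using \<phi>.nonneg_bounded by auto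
  have lower: "- (K\<^sup>2 / A) \<le> J f" for f
  proof -
    have "0 \<le> A * (norm f - K / A)\<^sup>2" using A by simp
    also have "\<dots> = A * (norm f)\<^sup>2 - 2 * (norm f * K) + K\<^sup>2 / A"
      using A by (simp add: power2_eq_square field_simps)
    also have "\<dots> \<le> J f + K\<^sup>2 / A"
      using A(2)[of f] K[of f] unfolding J_def by linarith
    finally show ?thesis by simp
  qed
  define m where "m = (INF f. J f)"
  have bdd: "bdd_below (range J)" using lower by (auto simp: bdd_below_def)
  have m_le: "m \<le> J f" for f unfolding m_def by (rule cINF_lower[OF bdd]) simp
  have "\<exists>f. J f < m + 1 / Suc n" for n
    using cINF_less_iff[of UNIV J "m + 1 / Suc n"] bdd unfolding m_def by force
  then obtain u where u: "\<And>n. J (u n) < m + 1 / Suc n" by metis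
  \<comment> \<open>The parallelogram identity bounds the distance of near-minimisers, since their midpoint
    cannot go below the infimum.\<close>
  have close: "A * (norm (f - g))\<^sup>2 \<le> 2 * (J f - m) + 2 * (J g - m)" for f g
  proof -
    have "b (f - g) (f - g) = 2 * J f + 2 * J g - 4 * J ((1/2) *\<^sub>R (f + g))"
      unfolding J_def
      by (simp add: b.diff_left b.diff_right b.add_left b.add_right b.scaleR_left b.scaleR_right
          \<phi>.add \<phi>.scaleR sym[of g f] field_simps)
    then show ?thesis
      using A(2)[of "f - g"] m_le[of "(1/2) *\<^sub>R (f + g)"] by simp
  qed
  have "Cauchy u"
  proof (rule metric_CauchyI)
    fix e :: real assume "0 < e"
    define r where "r = A * e\<^sup>2"
    have "0 < r / 4" unfolding r_def using A \<open>0 < e\<close> by simp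
    then obtain N where N: "inverse (real (Suc N)) < r / 4" using reals_Archimedean by blast
    have near: "J (u k) - m < r / 4" if "k \<ge> N" for k
    proof -
      have "1 / real (Suc k) \<le> inverse (real (Suc N))"
        using that by (simp add: field_simps)
      then show ?thesis using u[of k] N by linarith
    qed
    have "dist (u i) (u j) < e" if "i \<ge> N" "j \<ge> N" for i j
    proof -
      have "2 * (J (u i) - m) + 2 * (J (u j) - m) < r"
        using near[OF that(1)] near[OF that(2)] by argo
      then have "A * (norm (u i - u j))\<^sup>2 < A * e\<^sup>2"
        unfolding r_def by (rule le_less_trans[OF close])
      then have "(norm (u i - u j))\<^sup>2 < e\<^sup>2" using A by simp
      then show ?thesis unfolding dist_norm using \<open>0 < e\<close> by (simp add: power2_less_imp_less)
    qed
    then show "\<exists>M. \<forall>i\<ge>M. \<forall>j\<ge>M. dist (u i) (u j) < e" by blast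
  qed
  then obtain v where v: "u \<longlonglongrightarrow> v" using Cauchy_convergent convergentD by blast
  have "(\<lambda>n. J (u n)) \<longlonglongrightarrow> J v"
    unfolding J_def by (intro tendsto_intros b.tendsto \<phi>.tendsto v)
  moreover have "(\<lambda>n. m + 1 / real (Suc n)) \<longlonglongrightarrow> m"
    using tendsto_add[OF tendsto_const[of m] lim_inverse_n'[THEN LIMSEQ_Suc]] by simp
  ultimately have "J v \<le> m"
    using u by (intro LIMSEQ_le) (auto intro: less_imp_le)
  then have min: "J v \<le> J f" for f using m_le order_trans by blast
  have "b v g = \<phi> g" for g
  proof (rule ccontr)
    assume ne: "b v g \<noteq> \<phi> g"
    define d where "d = b v g - \<phi> g"
    define c where "c = b g g + 1"
    have "0 \<le> b g g" using A(2)[of g] A(1) by (meson less_imp_le mult_nonneg_nonneg order_trans zero_le_power2)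
    then have c: "0 < c" "b g g < c" by (auto simp: c_def)
    \<comment> \<open>The step \<open>- d / c\<close> along \<open>g\<close> would strictly decrease \<open>J\<close>.\<close>
    have "J (v + t *\<^sub>R g) - J v = 2 * t * d + t\<^sup>2 * b g g" for t
      unfolding J_def d_def
      by (simp add: b.add_left b.add_right b.scaleR_left b.scaleR_right
          \<phi>.add \<phi>.scaleR sym[of g v] power2_eq_square algebra_simps)
    from this[of "- d / c"]
    have "J (v + (- d / c) *\<^sub>R g) - J v = 2 * (- d / c) * d + (d / c)\<^sup>2 * b g g"
      by simp
    also have "\<dots> \<le> 2 * (- d / c) * d + (d / c)\<^sup>2 * c"
      using c by (intro add_left_mono mult_left_mono) auto
    also have "\<dots> = - (d\<^sup>2 / c)" using c by (simp add: power2_eq_square field_simps)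
    also have "\<dots> < 0" using c ne by (simp add: d_def)
    finally show False using min[of "v + (- d / c) *\<^sub>R g"] by linarith
  qed
  then show ?thesis by blast
qed

text \<open>The inner product is sesquilinear over the complex numbers; its real part is bilinear over the
  reals and determines it.\<close>

lemma bounded_bilinear_Re_cinner:
  "bounded_bilinear (\<lambda>f g::'a::complex_inner. Re (cinner f g))"
proof
  show "\<exists>K. \<forall>f g::'a. norm (Re (cinner f g)) \<le> norm f * norm g * K"
    by (intro exI[of _ 1]) (use abs_Re_le_cmod cmod_cinner_le order_trans in fastforce)
qed (simp_all add: cinner_add_left cinner_add_right cinner_scaleR_left cinner_scaleR_right)

text \<open>The functional is conjugate linear because it is represented in the second argument of the inner
  product. The real theory gives the identity of the real parts; that of the imaginary parts follows
  by replacing \<open>g\<close> with \<open>\<i> *\<^sub>C g\<close>.\<close>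

theorem riesz_representation:
  fixes L :: "'a::complex_hilbert \<Rightarrow> complex"
  assumes add: "\<And>f g. L (f + g) = L f + L g"
    and scaleC: "\<And>a f. L (a *\<^sub>C f) = cnj a * L f"
    and bound: "\<And>f. cmod (L f) \<le> C * norm f"
  shows "\<exists>u. \<forall>g. cinner u g = L g"
proof -
  have "bounded_linear (\<lambda>g. Re (L g))"
  proof (rule bounded_linear_intro)
    show "norm (Re (L g)) \<le> norm g * C" for g
      using order_trans[OF abs_Re_le_cmod bound[of g]] by (simp add: mult.commute)
  qed (simp_all add: add scaleC scaleR_eq_scaleC)
  moreover have "Re (cinner f g) = Re (cinner g f)" for f g :: 'a
    by (subst cinner_commute) simp
  moreover have "1 * (norm f)\<^sup>2 \<le> Re (cinner f f)" for f :: 'a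
    by (simp add: cinner_self)
  ultimately obtain u where u: "\<And>g. Re (cinner u g) = Re (L g)"
    using coercive_symmetric_form_represents[OF bounded_bilinear_Re_cinner _ zero_less_one]
    by blast
  have "cinner u g = L g" for g
    using u[of g] u[of "\<i> *\<^sub>C g"] by (simp add: complex_eq_iff cinner_scaleC_right scaleC)
  then show ?thesis by blast
qed

section \<open>Square-integrable functions\<close>

definition square_integrable :: "'x measure \<Rightarrow> ('x \<Rightarrow> complex) \<Rightarrow> bool" where
  "square_integrable M p \<longleftrightarrow> p \<in> borel_measurable M \<and> integrable M (\<lambda>x. (cmod (p x))\<^sup>2)"

lemma square_integrable_cnj:
  assumes "square_integrable M p"
  shows "square_integrable M (\<lambda>x. cnj (p x))"
proof -
  have "cnj \<in> borel_measurable borel"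
    by (rule borel_measurable_continuous_onI[OF linear_continuous_on[OF bounded_linear_cnj]])
  moreover have "p \<in> borel_measurable M" using assms by (simp add: square_integrable_def)
  ultimately have "(\<lambda>x. cnj (p x)) \<in> borel_measurable M"
    by (rule measurable_compose[rotated])
  then show ?thesis using assms by (simp add: square_integrable_def)
qed

lemma square_integrable_product:
  assumes "square_integrable M p" "square_integrable M q"
  shows "integrable M (\<lambda>x. p x * q x)"
proof -
  have [measurable]: "p \<in> borel_measurable M" "q \<in> borel_measurable M"
    using assms by (auto simp: square_integrable_def)
  have "integrable M (\<lambda>x. (cmod (p x))\<^sup>2 + (cmod (q x))\<^sup>2)"
    using assms by (auto simp: square_integrable_def)
  then show ?thesis
  proof (rule Bochner_Integration.integrable_bound)
    have "a * b \<le> a\<^sup>2 + b\<^sup>2" if "0 \<le> a" "0 \<le> b" for a b :: real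
      using sum_squares_bound[of a b] mult_nonneg_nonneg[OF that] by linarith
    then show "AE x in M. cmod (p x * q x) \<le> norm ((cmod (p x))\<^sup>2 + (cmod (q x))\<^sup>2)"
      by (simp add: norm_mult)
  qed measurable
qed

lemma cauchy_schwarz_integral:
  assumes "square_integrable M p" "square_integrable M q"
  shows "(cmod (\<integral>x. p x * q x \<partial>M))\<^sup>2 \<le> (\<integral>x. (cmod (p x))\<^sup>2 \<partial>M) * (\<integral>x. (cmod (q x))\<^sup>2 \<partial>M)"
proof -
  have [measurable]: "p \<in> borel_measurable M" "q \<in> borel_measurable M"
    and int: "integrable M (\<lambda>x. (cmod (p x))\<^sup>2)" "integrable M (\<lambda>x. (cmod (q x))\<^sup>2)"
    using assms by (auto simp: square_integrable_def)
  have "ennreal (cmod (\<integral>x. p x * q x \<partial>M)) \<le> (\<integral>\<^sup>+x. ennreal (cmod (p x * q x)) \<partial>M)"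
    by (rule integral_norm_bound_ennreal[OF square_integrable_product[OF assms]])
  also have "\<dots> = (\<integral>\<^sup>+x. ennreal (cmod (p x)) * ennreal (cmod (q x)) \<partial>M)"
    by (simp add: norm_mult ennreal_mult)
  finally have "(ennreal (cmod (\<integral>x. p x * q x \<partial>M)))\<^sup>2
      \<le> (\<integral>\<^sup>+x. ennreal (cmod (p x)) * ennreal (cmod (q x)) \<partial>M)\<^sup>2"
    by (rule power_mono) simp
  also have "\<dots> \<le> (\<integral>\<^sup>+x. (ennreal (cmod (p x)))\<^sup>2 \<partial>M) * (\<integral>\<^sup>+x. (ennreal (cmod (q x)))\<^sup>2 \<partial>M)"
    by (rule Cauchy_Schwarz_nn_integral) measurable
  also have "\<dots> = ennreal ((\<integral>x. (cmod (p x))\<^sup>2 \<partial>M) * (\<integral>x. (cmod (q x))\<^sup>2 \<partial>M))"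
    by (simp add: ennreal_power nn_integral_eq_integral int ennreal_mult)
  finally show ?thesis by (simp add: ennreal_power)
qed

section \<open>Bessel mappings\<close>

text \<open>A finite bound on the nonnegative integral of the squared modulus already contains
  square integrability, so the bounds that define Bessel mappings and frames can be moved to
  Lebesgue integrals of real functions.\<close>

lemma nn_integral_le_ennreal_iff:
  fixes p :: "'x \<Rightarrow> complex"
  assumes "p \<in> borel_measurable M" "0 \<le> C"
  shows "(\<integral>\<^sup>+x. ennreal ((cmod (p x))\<^sup>2) \<partial>M) \<le> ennreal C
    \<longleftrightarrow> square_integrable M p \<and> (\<integral>x. (cmod (p x))\<^sup>2 \<partial>M) \<le> C"
proof
  have [measurable]: "p \<in> borel_measurable M" by fact
  assume le: "(\<integral>\<^sup>+x. ennreal ((cmod (p x))\<^sup>2) \<partial>M) \<le> ennreal C"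
  then have "integrable M (\<lambda>x. (cmod (p x))\<^sup>2)"
    by (intro integrableI_bounded) (auto simp: le_less_trans)
  then show "square_integrable M p \<and> (\<integral>x. (cmod (p x))\<^sup>2 \<partial>M) \<le> C"
    using le assms by (simp add: square_integrable_def nn_integral_eq_integral)
next
  assume "square_integrable M p \<and> (\<integral>x. (cmod (p x))\<^sup>2 \<partial>M) \<le> C"
  then show "(\<integral>\<^sup>+x. ennreal ((cmod (p x))\<^sup>2) \<partial>M) \<le> ennreal C"
    using assms by (simp add: square_integrable_def nn_integral_eq_integral)
qed

lemma bessel_mapping_iff:
  "bessel_mapping M \<Phi> \<longleftrightarrow> (\<exists>B\<ge>0. \<forall>f. square_integrable M (analysis \<Phi> f) \<and>
     (\<integral>x. (cmod (analysis \<Phi> f x))\<^sup>2 \<partial>M) \<le> B * (norm f)\<^sup>2)"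
proof -
  have iff: "(\<integral>\<^sup>+x. ennreal ((cmod (cinner f (\<Phi> x)))\<^sup>2) \<partial>M) \<le> ennreal (B * (norm f)\<^sup>2)
      \<longleftrightarrow> square_integrable M (analysis \<Phi> f) \<and>
        (\<integral>x. (cmod (analysis \<Phi> f x))\<^sup>2 \<partial>M) \<le> B * (norm f)\<^sup>2"
    if "weakly_measurable M \<Phi>" "0 \<le> B" for B f
    unfolding analysis_def using that
    by (intro nn_integral_le_ennreal_iff) (auto simp: weakly_measurable_def)
  show ?thesis
  proof (cases "weakly_measurable M \<Phi>")
    case True
    then show ?thesis unfolding bessel_mapping_def using iff[OF True] by auto
  next
    case False
    then have "\<not> (\<forall>f. square_integrable M (analysis \<Phi> f))"
      by (auto simp: weakly_measurable_def analysis_def square_integrable_def)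
    with False show ?thesis unfolding bessel_mapping_def by blast
  qed
qed

lemma continuous_frame_iff:
  "continuous_frame M \<Phi> \<longleftrightarrow> bessel_mapping M \<Phi> \<and>
     (\<exists>A>0. \<forall>f. A * (norm f)\<^sup>2 \<le> (\<integral>x. (cmod (analysis \<Phi> f x))\<^sup>2 \<partial>M))"
proof -
  have eq: "(\<integral>\<^sup>+x. ennreal ((cmod (cinner f (\<Phi> x)))\<^sup>2) \<partial>M)
      = ennreal (\<integral>x. (cmod (analysis \<Phi> f x))\<^sup>2 \<partial>M)" if "bessel_mapping M \<Phi>" for f
    using that unfolding bessel_mapping_iff square_integrable_def
    by (auto simp: nn_integral_eq_integral analysis_def)
  have "continuous_frame M \<Phi> \<longleftrightarrow> bessel_mapping M \<Phi> \<and> (\<exists>A>0. \<forall>f. ennreal (A * (norm f)\<^sup>2)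
      \<le> (\<integral>\<^sup>+x. ennreal ((cmod (cinner f (\<Phi> x)))\<^sup>2) \<partial>M))"
    unfolding continuous_frame_def bessel_mapping_def by blast
  then show ?thesis by (auto simp: eq)
qed

lemma bessel_square_integrable:
  "bessel_mapping M \<Phi> \<Longrightarrow> square_integrable M (\<lambda>x. cinner f (\<Phi> x))"
  "bessel_mapping M \<Phi> \<Longrightarrow> square_integrable M (\<lambda>x. cinner (\<Phi> x) f)"
proof -
  assume "bessel_mapping M \<Phi>"
  then show *: "square_integrable M (\<lambda>x. cinner f (\<Phi> x))"
    by (auto simp: bessel_mapping_iff analysis_def)
  have "cinner (\<Phi> x) f = cnj (cinner f (\<Phi> x))" for x by (rule cinner_commute)
  then show "square_integrable M (\<lambda>x. cinner (\<Phi> x) f)"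
    using square_integrable_cnj[OF *] by simp
qed

lemma bessel_mapping_cong:
  assumes "\<And>x. x \<in> space M \<Longrightarrow> \<Phi> x = \<Psi> x"
  shows "bessel_mapping M \<Phi> \<longleftrightarrow> bessel_mapping M \<Psi>"
proof -
  have 1: "weakly_measurable M \<Phi> \<longleftrightarrow> weakly_measurable M \<Psi>"
    unfolding weakly_measurable_def using assms by (simp cong: measurable_cong)
  have 2: "(\<integral>\<^sup>+ x. ennreal ((cmod (cinner f (\<Phi> x)))\<^sup>2) \<partial>M)
      = (\<integral>\<^sup>+ x. ennreal ((cmod (cinner f (\<Psi> x)))\<^sup>2) \<partial>M)" for f
    using assms by (simp cong: nn_integral_cong)
  show ?thesis unfolding bessel_mapping_def 1 2 ..
qed

lemma bessel_mapping_diff: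
  assumes "bessel_mapping M \<Phi>" "bessel_mapping M \<Psi>"
  shows "bessel_mapping M (\<lambda>x. \<Phi> x - \<Psi> x)"
proof -
  obtain B where B: "0 \<le> B" "\<And>f. square_integrable M (analysis \<Phi> f)"
    "\<And>f. (\<integral>x. (cmod (analysis \<Phi> f x))\<^sup>2 \<partial>M) \<le> B * (norm f)\<^sup>2"
    using assms(1) by (auto simp: bessel_mapping_iff)
  obtain C where C: "0 \<le> C" "\<And>f. square_integrable M (analysis \<Psi> f)"
    "\<And>f. (\<integral>x. (cmod (analysis \<Psi> f x))\<^sup>2 \<partial>M) \<le> C * (norm f)\<^sup>2"
    using assms(2) by (auto simp: bessel_mapping_iff)
  have "square_integrable M (analysis (\<lambda>x. \<Phi> x - \<Psi> x) f) \<and>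
    (\<integral>x. (cmod (analysis (\<lambda>x. \<Phi> x - \<Psi> x) f x))\<^sup>2 \<partial>M) \<le> (2 * B + 2 * C) * (norm f)\<^sup>2" for f
  proof -
    have eq: "analysis (\<lambda>x. \<Phi> x - \<Psi> x) f = (\<lambda>x. analysis \<Phi> f x - analysis \<Psi> f x)"
      by (simp add: analysis_def cinner_diff_right)
    have [measurable]: "analysis \<Phi> f \<in> borel_measurable M" "analysis \<Psi> f \<in> borel_measurable M"
      and int: "integrable M (\<lambda>x. (cmod (analysis \<Phi> f x))\<^sup>2)"
        "integrable M (\<lambda>x. (cmod (analysis \<Psi> f x))\<^sup>2)"
      using B(2)[of f] C(2)[of f] by (auto simp: square_integrable_def)
    have pw: "(cmod (a - b))\<^sup>2 \<le> 2 * (cmod a)\<^sup>2 + 2 * (cmod b)\<^sup>2" for a b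
    proof -
      have "(cmod (a - b))\<^sup>2 \<le> (cmod a + cmod b)\<^sup>2"
        by (simp add: norm_triangle_ineq4 power_mono)
      then show ?thesis
        using sum_squares_bound[of "cmod a" "cmod b"] by (simp add: power2_sum)
    qed
    have int2: "integrable M (\<lambda>x. 2 * (cmod (analysis \<Phi> f x))\<^sup>2 + 2 * (cmod (analysis \<Psi> f x))\<^sup>2)"
      using int by simp
    have int3: "integrable M (\<lambda>x. (cmod (analysis \<Phi> f x - analysis \<Psi> f x))\<^sup>2)"
      by (rule Bochner_Integration.integrable_bound[OF int2]) (use pw in auto)
    have "(\<integral>x. (cmod (analysis \<Phi> f x - analysis \<Psi> f x))\<^sup>2 \<partial>M)
        \<le> (\<integral>x. 2 * (cmod (analysis \<Phi> f x))\<^sup>2 + 2 * (cmod (analysis \<Psi> f x))\<^sup>2 \<partial>M)"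
      by (rule integral_mono[OF int3 int2 pw])
    also have "\<dots> \<le> (2 * B + 2 * C) * (norm f)\<^sup>2"
      using int B(3)[of f] C(3)[of f] by (simp add: algebra_simps)
    finally show ?thesis using int3 by (simp add: eq square_integrable_def)
  qed
  then show ?thesis
    unfolding bessel_mapping_iff using B(1) C(1) by (intro exI[of _ "2 * B + 2 * C"]) auto
qed

text \<open>Composition with an operator \<open>L\<close> moves to the argument of the analysis map,
  \<open>\<langle>f, L (\<Phi> x)\<rangle> = \<langle>L' f, \<Phi> x\<rangle>\<close>. Stating the hypotheses through the adjoint \<open>L'\<close> gives both
  measurability and the bound.\<close>

lemma bessel_mapping_image:
  assumes "bessel_mapping M \<Phi>"
    and adj: "\<And>v f. cinner f (L v) = cinner (L' f) v"
    and bound: "\<And>f. norm (L' f) \<le> C * norm f"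
  shows "bessel_mapping M (\<lambda>x. L (\<Phi> x))"
proof -
  obtain B where B: "0 \<le> B" "\<And>f. square_integrable M (analysis \<Phi> f)"
    "\<And>f. (\<integral>x. (cmod (analysis \<Phi> f x))\<^sup>2 \<partial>M) \<le> B * (norm f)\<^sup>2"
    using assms(1) by (auto simp: bessel_mapping_iff)
  have eq: "analysis (\<lambda>x. L (\<Phi> x)) f = analysis \<Phi> (L' f)" for f
    by (simp add: analysis_def adj)
  have "B * (norm (L' f))\<^sup>2 \<le> (B * C\<^sup>2) * (norm f)\<^sup>2" for f
  proof -
    have "(norm (L' f))\<^sup>2 \<le> (C * norm f)\<^sup>2" by (simp add: bound power_mono)
    then show ?thesis using B(1) by (simp add: mult_left_mono power_mult_distrib mult.assoc)
  qed
  then show ?thesis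
    unfolding bessel_mapping_iff eq using B
    by (intro exI[of _ "B * C\<^sup>2"]) (auto intro: order_trans)
qed

section \<open>Mixed frame operators\<close>

text \<open>The weak integral exists because \<open>g \<mapsto> \<integral> p x * \<langle>\<Psi> x, g\<rangle>\<close> is a bounded conjugate linear functional,
  by the Cauchy--Schwarz inequality and the Bessel bound.\<close>

lemma has_weak_integral_synthesis:
  assumes p: "square_integrable M p" and "bessel_mapping M \<Psi>"
  shows "has_weak_integral M (\<lambda>x. p x *\<^sub>C \<Psi> x) (synthesis M \<Psi> p)"
proof -
  obtain B where B: "0 \<le> B" "\<And>f. square_integrable M (analysis \<Psi> f)"
    "\<And>f. (\<integral>x. (cmod (analysis \<Psi> f x))\<^sup>2 \<partial>M) \<le> B * (norm f)\<^sup>2"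
    using assms(2) by (auto simp: bessel_mapping_iff)
  note sq = bessel_square_integrable(2)[OF assms(2)]
  define L where "L g = (\<integral>x. p x * cinner (\<Psi> x) g \<partial>M)" for g
  note int = square_integrable_product[OF p sq]
  define P where "P = (\<integral>x. (cmod (p x))\<^sup>2 \<partial>M)"
  have P: "0 \<le> P" unfolding P_def by simp
  have "\<exists>u. \<forall>g. cinner u g = L g"
  proof (rule riesz_representation)
    show "L (f + g) = L f + L g" for f g
      unfolding L_def using int by (simp add: cinner_add_right distrib_left)
    show "L (a *\<^sub>C f) = cnj a * L f" for a f
      unfolding L_def by (simp add: cinner_scaleC_right mult.left_commute)
    show "cmod (L g) \<le> sqrt (P * B) * norm g" for g
    proof -
      have "cmod (cinner (\<Psi> x) g) = cmod (analysis \<Psi> g x)" for x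
        unfolding analysis_def by (subst cinner_commute) simp
      then have "(cmod (L g))\<^sup>2 \<le> P * (\<integral>x. (cmod (analysis \<Psi> g x))\<^sup>2 \<partial>M)"
        unfolding L_def P_def using cauchy_schwarz_integral[OF p sq[of g]] by simp
      also have "\<dots> \<le> P * (B * (norm g)\<^sup>2)" using B(3) P by (rule mult_left_mono)
      also have "\<dots> = (sqrt (P * B) * norm g)\<^sup>2" using P B(1) by (simp add: power_mult_distrib)
      finally show ?thesis by (rule power2_le_imp_le) (simp add: P B(1))
    qed
  qed
  then obtain u where "\<And>g. cinner u g = L g" by blast
  then have "has_weak_integral M (\<lambda>x. p x *\<^sub>C \<Psi> x) u"
    unfolding has_weak_integral_def using int by (simp add: cinner_scaleC_left L_def)
  then show ?thesis unfolding synthesis_def by (simp add: weak_integral_eq)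
qed

definition mixed_operator ::
    "'x measure \<Rightarrow> ('x \<Rightarrow> 'h::complex_hilbert) \<Rightarrow> ('x \<Rightarrow> 'h) \<Rightarrow> 'h \<Rightarrow> 'h" where
  "mixed_operator M \<Phi> \<Psi> = synthesis M \<Psi> \<circ> analysis \<Phi>"

lemma frame_operator_eq_mixed: "frame_operator M F = mixed_operator M F F"
  by (simp add: frame_operator_def mixed_operator_def)

lemma mixed_operator_eq_weak_integral:
  "mixed_operator M \<Phi> \<Psi> f = weak_integral M (\<lambda>x. cinner f (\<Phi> x) *\<^sub>C \<Psi> x)"
  by (simp add: mixed_operator_def synthesis_def analysis_def)

text \<open>A formula for \<open>G\<close> on \<open>space M\<close> says nothing about its values elsewhere; this lemma and
  \<open>bessel_mapping_cong\<close> make those values irrelevant.\<close>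

lemma mixed_operator_cong:
  assumes "\<And>x. x \<in> space M \<Longrightarrow> \<Psi> x = \<Psi>' x"
  shows "mixed_operator M \<Phi> \<Psi> = mixed_operator M \<Phi> \<Psi>'"
proof
  fix f
  have "has_weak_integral M (\<lambda>x. cinner f (\<Phi> x) *\<^sub>C \<Psi> x) v
      \<longleftrightarrow> has_weak_integral M (\<lambda>x. cinner f (\<Phi> x) *\<^sub>C \<Psi>' x) v" for v
    unfolding has_weak_integral_def
    by (intro iff_allI arg_cong2[where f = "(\<and>)"] arg_cong2[where f = "(=)"]
        Bochner_Integration.integrable_cong Bochner_Integration.integral_cong refl)
      (simp_all add: assms)
  then show "mixed_operator M \<Phi> \<Psi> f = mixed_operator M \<Phi> \<Psi>' f"
    unfolding mixed_operator_eq_weak_integral weak_integral_def by (intro arg_cong[of _ _ The] ext)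
qed

lemma cinner_mixed_operator:
  assumes "bessel_mapping M \<Phi>" "bessel_mapping M \<Psi>"
  shows "cinner (mixed_operator M \<Phi> \<Psi> f) g = (\<integral>x. cinner f (\<Phi> x) * cinner (\<Psi> x) g \<partial>M)"
proof -
  have "mixed_operator M \<Phi> \<Psi> f = synthesis M \<Psi> (\<lambda>x. cinner f (\<Phi> x))"
    by (simp add: mixed_operator_def analysis_def)
  then show ?thesis
    using has_weak_integral_synthesis[OF bessel_square_integrable(1)[OF assms(1)] assms(2), of f]
    unfolding has_weak_integral_def cinner_scaleC_left by metis
qed

lemma mixed_operator_adjoint:
  fixes \<Phi> \<Psi> :: "'x \<Rightarrow> 'a::complex_hilbert"
  assumes "bessel_mapping M \<Phi>" "bessel_mapping M \<Psi>"
  shows "cinner (mixed_operator M \<Phi> \<Psi> f) g = cinner f (mixed_operator M \<Psi> \<Phi> g)"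
proof -
  have cnj: "cnj (cinner u v) = cinner v u" for u v :: 'a
    by (rule cinner_commute[symmetric])
  have "cinner f (mixed_operator M \<Psi> \<Phi> g) = cnj (\<integral>x. cinner g (\<Psi> x) * cinner (\<Phi> x) f \<partial>M)"
    unfolding cinner_mixed_operator[OF assms(2,1), symmetric] by (rule cinner_commute)
  also have "\<dots> = (\<integral>x. cnj (cinner g (\<Psi> x) * cinner (\<Phi> x) f) \<partial>M)"
    by (rule Bochner_Integration.integral_cnj[symmetric])
  also have "\<dots> = (\<integral>x. cinner f (\<Phi> x) * cinner (\<Psi> x) g \<partial>M)"
    unfolding complex_cnj_mult cnj by (rule Bochner_Integration.integral_cong[OF refl mult.commute])
  finally show ?thesis unfolding cinner_mixed_operator[OF assms] by simp
qed

lemma mixed_operator_bounded: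
  assumes "bessel_mapping M \<Phi>" "bessel_mapping M \<Psi>"
  obtains C where "0 \<le> C" "\<And>f. norm (mixed_operator M \<Phi> \<Psi> f) \<le> C * norm f"
proof -
  obtain B where B: "0 \<le> B" "\<And>f. (\<integral>x. (cmod (analysis \<Phi> f x))\<^sup>2 \<partial>M) \<le> B * (norm f)\<^sup>2"
    using assms(1) by (auto simp: bessel_mapping_iff)
  obtain B' where B': "0 \<le> B'" "\<And>f. (\<integral>x. (cmod (analysis \<Psi> f x))\<^sup>2 \<partial>M) \<le> B' * (norm f)\<^sup>2"
    using assms(2) by (auto simp: bessel_mapping_iff)
  have "norm (mixed_operator M \<Phi> \<Psi> f) \<le> sqrt (B * B') * norm f" for f
  proof (rule norm_le_of_cinner_bound)
    show "0 \<le> sqrt (B * B') * norm f" using B(1) B'(1) by simp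
    fix g
    have "cmod (cinner (\<Psi> x) g) = cmod (analysis \<Psi> g x)" for x
      unfolding analysis_def by (subst cinner_commute) simp
    then have "(cmod (cinner (mixed_operator M \<Phi> \<Psi> f) g))\<^sup>2
        \<le> (\<integral>x. (cmod (analysis \<Phi> f x))\<^sup>2 \<partial>M) * (\<integral>x. (cmod (analysis \<Psi> g x))\<^sup>2 \<partial>M)"
      using cauchy_schwarz_integral[OF bessel_square_integrable(1)[OF assms(1), of f]
          bessel_square_integrable(2)[OF assms(2), of g]]
      by (simp add: cinner_mixed_operator[OF assms] analysis_def)
    also have "\<dots> \<le> (B * (norm f)\<^sup>2) * (B' * (norm g)\<^sup>2)"
      using B B' by (intro mult_mono) auto
    also have "\<dots> = (sqrt (B * B') * norm f * norm g)\<^sup>2"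
      using B(1) B'(1) by (simp add: power_mult_distrib)
    finally show "cmod (cinner (mixed_operator M \<Phi> \<Psi> f) g) \<le> sqrt (B * B') * norm f * norm g"
      by (rule power2_le_imp_le) (simp add: B(1) B'(1))
  qed
  then show ?thesis using that[of "sqrt (B * B')"] B(1) B'(1) by simp
qed

section \<open>The frame operator\<close>

lemma cinner_frame_operator_self:
  assumes "bessel_mapping M F"
  shows "cinner (frame_operator M F f) f = of_real (\<integral>x. (cmod (analysis F f x))\<^sup>2 \<partial>M)"
proof -
  have "cinner f (F x) * cinner (F x) f = of_real ((cmod (analysis F f x))\<^sup>2)" for x
    using complex_norm_square[of "cinner f (F x)"] cinner_commute[of "F x" f]
    by (simp add: analysis_def)
  then show ?thesis
    by (simp add: frame_operator_eq_mixed cinner_mixed_operator[OF assms assms]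
        del: of_real_power)
qed

text \<open>The lower frame bound says that \<open>\<langle>S f, f\<rangle> \<ge> A * (norm f)\<^sup>2\<close> for the self-adjoint operator \<open>S\<close>.
  Hence \<open>A * norm f \<le> norm (S f)\<close>, which gives injectivity and the bound on the inverse, and the
  form \<open>\<langle>S f, g\<rangle>\<close> is coercive and symmetric, which gives surjectivity. Linearity of \<open>S\<close> is read
  off from self-adjointness.\<close>

lemma frame_operator_invertible:
  fixes F :: "'x \<Rightarrow> 'h::complex_hilbert"
  assumes "continuous_frame M F"
  obtains C where "bij (frame_operator M F)"
    and "\<And>f. norm (inv (frame_operator M F) f) \<le> C * norm f"
    and "\<And>f g. cinner (inv (frame_operator M F) f) g = cinner f (inv (frame_operator M F) g)"
proof -
  let ?S = "frame_operator M F"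
  obtain A where bes: "bessel_mapping M F" and A: "0 < A"
    "\<And>f. A * (norm f)\<^sup>2 \<le> (\<integral>x. (cmod (analysis F f x))\<^sup>2 \<partial>M)"
    using assms by (auto simp: continuous_frame_iff)
  have selfadj: "cinner (?S f) g = cinner f (?S g)" for f g
    using mixed_operator_adjoint[OF bes bes] by (simp add: frame_operator_eq_mixed)
  obtain K where K: "0 \<le> K" "\<And>f. norm (?S f) \<le> K * norm f"
    using mixed_operator_bounded[OF bes bes] by (auto simp: frame_operator_eq_mixed)
  have coercive: "A * (norm f)\<^sup>2 \<le> Re (cinner (?S f) f)" for f
    using A(2)[of f] by (simp add: cinner_frame_operator_self[OF bes])
  have below: "A * norm f \<le> norm (?S f)" for f
  proof (cases "f = 0")
    case False
    have "A * (norm f)\<^sup>2 \<le> norm (?S f) * norm f"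
      using coercive[of f] complex_Re_le_cmod[of "cinner (?S f) f"] cmod_cinner_le[of "?S f" f]
      by linarith
    then show ?thesis using False by (simp add: power2_eq_square flip: mult.assoc)
  qed simp
  have diff: "?S (f - g) = ?S f - ?S g" for f g
    by (rule cinner_eqI) (simp add: selfadj cinner_diff_left)
  have "inj ?S"
  proof (rule injI)
    fix f g assume "?S f = ?S g"
    then have "A * norm (f - g) \<le> 0" using below[of "f - g"] by (simp add: diff)
    then show "f = g" using A(1) by (simp add: mult_le_0_iff)
  qed
  moreover have "surj ?S"
  proof (rule surjI)
    have bb: "bounded_bilinear (\<lambda>f g. Re (cinner (?S f) g))"
    proof
      have "norm (Re (cinner (?S f) g)) \<le> norm f * norm g * K" for f g
      proof -
        have "norm (Re (cinner (?S f) g)) \<le> norm (?S f) * norm g"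
          using abs_Re_le_cmod cmod_cinner_le order_trans by fastforce
        also have "\<dots> \<le> (K * norm f) * norm g" using K by (simp add: mult_right_mono)
        finally show ?thesis by (simp add: mult_ac)
      qed
      then show "\<exists>K. \<forall>f g. norm (Re (cinner (?S f) g)) \<le> norm f * norm g * K" by blast
    qed (simp_all add: selfadj cinner_add_left cinner_scaleR_left,
         simp_all add: cinner_add_right cinner_scaleR_right flip: selfadj)
    show "?S (SOME u. ?S u = v) = v" for v
    proof -
      have sym: "Re (cinner (?S f) g) = Re (cinner (?S g) f)" for f g
        unfolding selfadj[of f g] by (subst cinner_commute) simp
      have "bounded_linear (\<lambda>g. Re (cinner v g))"
        by (rule bounded_bilinear.bounded_linear_right[OF bounded_bilinear_Re_cinner])
      from coercive_symmetric_form_represents[OF bb sym A(1) coercive this]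
      obtain u where u: "\<And>g. Re (cinner (?S u) g) = Re (cinner v g)" by blast
      have "Re (cinner (?S u - v) (?S u - v)) = 0"
        unfolding cinner_diff_left using u[of "?S u - v"] by simp
      then have "?S u = v" unfolding cinner_self by simp
      then show ?thesis by (rule someI)
    qed
  qed
  ultimately have bij: "bij ?S" by (simp add: bij_def)
  note SI = surj_f_inv_f[OF \<open>surj ?S\<close>]
  have bound: "norm (inv ?S f) \<le> (1 / A) * norm f" for f
    using below[of "inv ?S f"] A(1) by (simp add: SI field_simps)
  have inv_selfadj: "cinner (inv ?S f) g = cinner f (inv ?S g)" for f g
    using selfadj[of "inv ?S f" "inv ?S g"] by (simp add: SI)
  show ?thesis by (rule that[OF bij bound inv_selfadj])
qed

section \<open>Dual frames\<close>

text \<open>Duality and the Cauchy--Schwarz inequality give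
  \<open>(norm f)\<^sup>4 \<le> B * (norm f)\<^sup>2 * \<integral> \<bar>\<langle>f, G x\<rangle>\<bar>\<^sup>2\<close> with \<open>B\<close> a Bessel bound of \<open>F\<close>. So a Bessel
  mapping that satisfies the duality identity has a positive lower frame bound.\<close>

lemma dual_frame_iff:
  assumes F: "bessel_mapping M F"
  shows "dual_frame M F G \<longleftrightarrow> bessel_mapping M G \<and> mixed_operator M F G = id"
proof
  assume "dual_frame M F G"
  then have G: "bessel_mapping M G"
    and dual: "\<And>f g. cinner f g = (\<integral>x. cinner f (F x) * cinner (G x) g \<partial>M)"
    unfolding dual_frame_def continuous_frame_iff by blast+
  have "mixed_operator M F G f = f" for f
    by (rule cinner_eqI) (simp only: cinner_mixed_operator[OF F G] dual[symmetric])
  with G show "bessel_mapping M G \<and> mixed_operator M F G = id" by auto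
next
  assume "bessel_mapping M G \<and> mixed_operator M F G = id"
  then have G: "bessel_mapping M G" and id: "\<And>f. mixed_operator M F G f = f" by auto
  have dual: "cinner f g = (\<integral>x. cinner f (F x) * cinner (G x) g \<partial>M)" for f g
    using cinner_mixed_operator[OF F G, of f g] by (simp add: id)
  obtain B where B: "0 \<le> B" "\<And>f. (\<integral>x. (cmod (analysis F f x))\<^sup>2 \<partial>M) \<le> B * (norm f)\<^sup>2"
    using F by (auto simp: bessel_mapping_iff)
  \<comment> \<open>The Bessel bound \<open>B\<close> may be zero, hence the enlargement to \<open>B + 1\<close>.\<close>
  have "1 / (B + 1) * (norm f)\<^sup>2 \<le> (\<integral>x. (cmod (analysis G f x))\<^sup>2 \<partial>M)" (is "_ \<le> ?I") for f
  proof (cases "f = 0")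
    case False
    have I: "0 \<le> ?I" by simp
    have "cmod (cinner (G x) f) = cmod (analysis G f x)" for x
      unfolding analysis_def by (subst cinner_commute) simp
    then have "(cmod (cinner f f))\<^sup>2 \<le> (\<integral>x. (cmod (analysis F f x))\<^sup>2 \<partial>M) * ?I"
      using cauchy_schwarz_integral[OF bessel_square_integrable(1)[OF F, of f]
          bessel_square_integrable(2)[OF G, of f]]
      unfolding dual[of f f, symmetric] by (simp add: analysis_def)
    also have "\<dots> \<le> ((B + 1) * (norm f)\<^sup>2) * ?I"
      using B(2)[of f] I by (intro mult_right_mono) (auto simp: distrib_right add_increasing2)
    finally have "((norm f)\<^sup>2)\<^sup>2 \<le> (B + 1) * (norm f)\<^sup>2 * ?I"
      by (simp only: cinner_self norm_of_real abs_power2)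
    then have "(norm f)\<^sup>2 * (norm f)\<^sup>2 \<le> (norm f)\<^sup>2 * ((B + 1) * ?I)"
      by (simp only: power2_eq_square[of "(norm f)\<^sup>2"] mult_ac)
    then have "(norm f)\<^sup>2 \<le> (B + 1) * ?I"
      by (rule mult_left_le_imp_le) (simp add: False)
    then show ?thesis using B(1) by (simp add: field_simps)
  qed simp
  moreover have "0 < 1 / (B + 1)" using B(1) by simp
  ultimately have "continuous_frame M G" using G unfolding continuous_frame_iff by blast
  then show "dual_frame M F G" unfolding dual_frame_def using dual by blast
qed

lemma mixed_operator_diff_right:
  assumes "bessel_mapping M \<Phi>" "bessel_mapping M \<Psi>" "bessel_mapping M \<Psi>'"
  shows "mixed_operator M \<Phi> (\<lambda>x. \<Psi> x - \<Psi>' x) f = mixed_operator M \<Phi> \<Psi> f - mixed_operator M \<Phi> \<Psi>' f"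
proof (rule cinner_eqI)
  fix g
  note int = square_integrable_product[OF bessel_square_integrable(1)[OF assms(1), of f]
      bessel_square_integrable(2)]
  show "cinner (mixed_operator M \<Phi> (\<lambda>x. \<Psi> x - \<Psi>' x) f) g
      = cinner (mixed_operator M \<Phi> \<Psi> f - mixed_operator M \<Phi> \<Psi>' f) g"
    using int[OF assms(2), of g] int[OF assms(3), of g]
    by (simp add: cinner_mixed_operator assms bessel_mapping_diff cinner_diff_left right_diff_distrib)
qed

lemma mixed_operator_image_right:
  assumes "bessel_mapping M \<Phi>" "bessel_mapping M \<Psi>"
    and adj: "\<And>v f. cinner f (L v) = cinner (L' f) v"
    and bound: "\<And>f. norm (L' f) \<le> C * norm f"
  shows "mixed_operator M \<Phi> (\<lambda>x. L (\<Psi> x)) f = L (mixed_operator M \<Phi> \<Psi> f)"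
proof (rule cinner_eqI)
  fix g
  have adj': "cinner (L v) g = cinner v (L' g)" for v
    using adj[of g v] by (metis cinner_commute)
  show "cinner (mixed_operator M \<Phi> (\<lambda>x. L (\<Psi> x)) f) g = cinner (L (mixed_operator M \<Phi> \<Psi> f)) g"
    using bessel_mapping_image[OF assms(2) adj bound] assms(1,2)
    by (simp add: cinner_mixed_operator adj')
qed

theorem theorem4p5:
  fixes M :: "'x measure" and F :: "'x \<Rightarrow> 'h::complex_hilbert"
  assumes "separable_space (euclidean :: 'h topology)"
    and "sigma_finite_measure M"
    and "continuous_frame M F"
  shows "\<forall>G :: 'x \<Rightarrow> 'h. dual_frame M F G \<longleftrightarrow>
    (\<exists>\<Theta> :: 'x \<Rightarrow> 'h. bessel_mapping M \<Theta> \<and>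
      (\<forall>x\<in>space M. G x =
        inv (frame_operator M F) (F x) + \<Theta> x
        - weak_integral M (\<lambda>y. cinner (inv (frame_operator M F) (F x)) (F y) *\<^sub>C \<Theta> y)))"
proof
  fix G :: "'x \<Rightarrow> 'h"
  define R where "R = inv (frame_operator M F)"
  have F: "bessel_mapping M F" using assms(3) by (simp add: continuous_frame_iff)
  obtain C where bij: "bij (frame_operator M F)"
    and R_bound: "\<And>f. norm (R f) \<le> C * norm f"
    and R_adj: "\<And>f g. cinner (R f) g = cinner f (R g)"
    unfolding R_def by (rule frame_operator_invertible[OF assms(3)]) iprover
  have RS: "R (mixed_operator M F F f) = f" for f
    using bij by (simp add: R_def bij_is_inj frame_operator_eq_mixed)
  have "dual_frame M F G \<longleftrightarrow> (\<exists>\<Theta>. bessel_mapping M \<Theta> \<and>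
      (\<forall>x\<in>space M. G x = R (F x) + \<Theta> x - mixed_operator M F \<Theta> (R (F x))))"
  proof
    assume "dual_frame M F G"
    then have "bessel_mapping M G" "mixed_operator M F G = id"
      by (simp_all add: dual_frame_iff[OF F])
    then show "\<exists>\<Theta>. bessel_mapping M \<Theta> \<and>
        (\<forall>x\<in>space M. G x = R (F x) + \<Theta> x - mixed_operator M F \<Theta> (R (F x)))"
      by (intro exI[of _ G]) simp
  next
    assume "\<exists>\<Theta>. bessel_mapping M \<Theta> \<and>
        (\<forall>x\<in>space M. G x = R (F x) + \<Theta> x - mixed_operator M F \<Theta> (R (F x)))"
    then obtain \<Theta> where \<Theta>: "bessel_mapping M \<Theta>"
      and G: "\<And>x. x \<in> space M \<Longrightarrow> G x = R (F x) + \<Theta> x - mixed_operator M F \<Theta> (R (F x))" by blast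
    define T where "T = mixed_operator M F \<Theta>"
    \<comment> \<open>On \<open>space M\<close> the given formula is \<open>G = \<Theta> - U \<circ> F\<close> with \<open>U = (T - id) R\<close>, and \<open>U'\<close> is
      the adjoint of \<open>U\<close>.\<close>
    define U where "U v = T (R v) - R v" for v
    define U' where "U' f = R (mixed_operator M \<Theta> F f) - R f" for f
    obtain D where D: "0 \<le> D" "\<And>f. norm (mixed_operator M \<Theta> F f) \<le> D * norm f"
      using mixed_operator_bounded[OF \<Theta> F] by metis
    have U_adj: "cinner f (U v) = cinner (U' f) v" for f v
      using mixed_operator_adjoint[OF \<Theta> F]
      by (simp add: U_def U'_def T_def cinner_diff_left cinner_diff_right R_adj)
    have U'_bound: "norm (U' f) \<le> (\<bar>C\<bar> * D + \<bar>C\<bar>) * norm f" for f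
    proof -
      have "norm (R h) \<le> \<bar>C\<bar> * norm h" for h
        using R_bound[of h] by (meson abs_ge_self mult_right_mono norm_ge_zero order_trans)
      from this[of f] this[of "mixed_operator M \<Theta> F f"]
      have "norm (U' f) \<le> \<bar>C\<bar> * norm (mixed_operator M \<Theta> F f) + \<bar>C\<bar> * norm f"
        unfolding U'_def using norm_triangle_ineq4 order_trans add_mono by smt
      also have "\<dots> \<le> \<bar>C\<bar> * (D * norm f) + \<bar>C\<bar> * norm f"
        by (intro add_mono mult_left_mono D order_refl) auto
      finally show ?thesis by (simp add: algebra_simps)
    qed
    have UF: "bessel_mapping M (\<lambda>x. U (F x))"
      by (rule bessel_mapping_image[OF F U_adj U'_bound])
    have G_eq: "G x = \<Theta> x - U (F x)" if "x \<in> space M" for x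
      using G[OF that] by (simp add: U_def T_def algebra_simps)
    have "mixed_operator M F (\<lambda>x. \<Theta> x - U (F x)) f = T f - U (mixed_operator M F F f)" for f
      unfolding mixed_operator_diff_right[OF F \<Theta> UF]
        mixed_operator_image_right[OF F F U_adj U'_bound] T_def ..
    then have "mixed_operator M F (\<lambda>x. \<Theta> x - U (F x)) f = f" for f
      by (simp add: U_def RS)
    then have "dual_frame M F (\<lambda>x. \<Theta> x - U (F x))"
      using bessel_mapping_diff[OF \<Theta> UF] by (auto simp: dual_frame_iff[OF F])
    moreover have "bessel_mapping M G \<longleftrightarrow> bessel_mapping M (\<lambda>x. \<Theta> x - U (F x))"
      by (rule bessel_mapping_cong) (rule G_eq)
    moreover have "mixed_operator M F G = mixed_operator M F (\<lambda>x. \<Theta> x - U (F x))"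
      by (rule mixed_operator_cong) (rule G_eq)
    ultimately show "dual_frame M F G" by (simp add: dual_frame_iff[OF F])
  qed
  then show "dual_frame M F G \<longleftrightarrow> (\<exists>\<Theta>. bessel_mapping M \<Theta> \<and>
      (\<forall>x\<in>space M. G x = inv (frame_operator M F) (F x) + \<Theta> x
        - weak_integral M (\<lambda>y. cinner (inv (frame_operator M F) (F x)) (F y) *\<^sub>C \<Theta> y)))"
    by (simp add: R_def mixed_operator_eq_weak_integral)
qed

end
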